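(* Let $\mathbf{X}\in\mathbb{R}^{a\times b}$, $\mathbf{W}\in\mathbb{R}^{b\times c}$, $\mathbf{Y}\in\mathbb{R}^{c\times d}$, and for $\widetilde{\mathbf{W}}\in\mathbb{R}^{b\times c}$ define $$g(\widetilde{\mathbf{W}}) := \|\mathbf{X}(\widetilde{\mathbf{W}}-\mathbf{W})\|_F+\|(\widetilde{\mathbf{W}}-\mathbf{W})\mathbf{Y}\|_F .$$ Fix $j\in\{1,\dots,b\}$ and $k\in\{1,\dots,c\}$, and let $\widetilde{\mathbf{W}}$ be the matrix with $\widetilde{\mathbf{W}}_{jk}=0$ and $\widetilde{\mathbf{W}}_{j'k'}=\mathbf{W}_{j'k'}$ for all $(j',k')\neq(j,k)$. Then $$g(\widetilde{\mathbf{W}})=|\mathbf{W}_{jk}|\left(\|\mathbf{X}_{:j}\|_2+\|\mathbf{Y}_{k:}\|_2\right).$$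
   Context: $\|\cdot\|_F$ is the Frobenius norm (not squared in $g$) and $\|\cdot\|_2$ the Euclidean norm of a vector. $\mathbf{M}_{:j}$ denotes the $j$-th column and $\mathbf{M}_{k:}$ the $k$-th row of a matrix $\mathbf{M}$. *)

theory Defs
  imports "HOL-Analysis.Analysis"
begin

definition frob_norm :: "real ^ 'n ^ 'm \<Rightarrow> real" where
  "frob_norm A = sqrt (\<Sum>i\<in>UNIV. \<Sum>j\<in>UNIV. (A $ i $ j)\<^sup>2)"

text \<open>The library norm on nested vectors is the Frobenius norm.\<close>

lemma frob_norm_eq_norm: "frob_norm A = norm A"
  by (simp add: frob_norm_def norm_vec_def L2_set_def sum_nonneg)

definition g ::
  "real ^ 'b ^ 'a \<Rightarrow> real ^ 'c ^ 'b \<Rightarrow> real ^ 'd ^ 'c \<Rightarrow> real ^ 'c ^ 'b \<Rightarrow> real" where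
  "g X W Y W' = frob_norm (X ** (W' - W)) + frob_norm ((W' - W) ** Y)"

end

theory Submission
  imports Defs
begin

text \<open>Zeroing one weight perturbs \<open>W\<close> by \<open>e\<close> times the matrix unit
  E_jk, with e = -W_jk. Right multiplication by E_jk moves column \<open>j\<close> of
  \<open>X\<close> into column \<open>k\<close> and kills everything else; left multiplication moves
  row \<open>k\<close> of \<open>Y\<close> into row \<open>j\<close>. Each product thus has a single
  nonzero line at most, and its Frobenius norm is |e| times the Euclidean norm of that line. The two
  lemmas compute these norms for arbitrary \<open>e\<close>.\<close>

lemma frob_norm_matrix_mult_single_entry:
  fixes X :: "real ^ 'b ^ 'a" and k :: "'c::finite"
  shows "frob_norm (X ** (\<chi> p q. if p = j \<and> q = k then e else 0)) = \<bar>e\<bar> * norm (column j X)"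
proof -
  have "(X ** (\<chi> p q. if p = j \<and> q = k then e else 0)) $ i $ l
      = (if l = k then X $ i $ j * e else 0)" for i l
    by (simp add: matrix_matrix_mult_def if_distrib cong: if_cong)
  \<comment> \<open>Only column \<open>k\<close> survives, so the inner sum over columns collapses
    to one term in each row.\<close>
  then have "frob_norm (X ** (\<chi> p q. if p = j \<and> q = k then e else 0))
      = sqrt (e\<^sup>2 * (\<Sum>i\<in>UNIV. (X $ i $ j)\<^sup>2))"
    by (simp add: frob_norm_def if_distrib[of "\<lambda>x. x\<^sup>2"] power_mult_distrib
        sum_distrib_left mult.commute cong: if_cong)
  then show ?thesis
    by (simp add: real_sqrt_mult norm_vec_def L2_set_def column_def)
qed

lemma frob_norm_single_entry_matrix_mult:
  fixes Y :: "real ^ 'd ^ 'c" and j :: "'b::finite"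
  shows "frob_norm ((\<chi> p q. if p = j \<and> q = k then e else 0) ** Y) = \<bar>e\<bar> * norm (row k Y)"
proof -
  have "((\<chi> p q. if p = j \<and> q = k then e else 0) ** Y) $ i $ l
      = (if i = j then e * Y $ k $ l else 0)" for i l
    by (simp add: matrix_matrix_mult_def if_distrib[of "\<lambda>x. x * _"] cong: if_cong)
  \<comment> \<open>Here the surviving line is a row, so the condition \<open>i = j\<close> concerns
    the outer index. It is pulled out of the whole inner sum so that the outer sum
    collapses.\<close>
  then have "frob_norm ((\<chi> p q. if p = j \<and> q = k then e else 0) ** Y)
      = sqrt (\<Sum>i\<in>UNIV. if i = j then e\<^sup>2 * (\<Sum>l\<in>UNIV. (Y $ k $ l)\<^sup>2) else 0)"
    unfolding frob_norm_def
    by (intro arg_cong[where f = sqrt] sum.cong)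
      (auto simp: power_mult_distrib sum_distrib_left)
  then show ?thesis
    by (simp add: real_sqrt_mult norm_vec_def L2_set_def row_def)
qed

theorem lemma3p1:
  fixes X :: "real ^ 'b ^ 'a"
    and W W' :: "real ^ 'c ^ 'b"
    and Y :: "real ^ 'd ^ 'c"
    and j :: 'b and k :: 'c
  assumes "W' $ j $ k = 0"
    and "\<And>j' k'. (j', k') \<noteq> (j, k) \<Longrightarrow> W' $ j' $ k' = W $ j' $ k'"
  shows "g X W Y W' = \<bar>W $ j $ k\<bar> * (norm (column j X) + norm (row k Y))"
proof -
  \<comment> \<open>The minus sign disappears in the absolute value that both lemmas
    produce.\<close>
  have "W' - W = (\<chi> p q. if p = j \<and> q = k then - W $ j $ k else 0)"
    using assms by (auto simp: vec_eq_iff)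
  then show ?thesis
    by (simp add: g_def frob_norm_matrix_mult_single_entry frob_norm_single_entry_matrix_mult
        distrib_left)
qed

end
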